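(* For all integers $k,r\geq 2$, \[ f_r(k)\geq k^r. \]
   Context: An $r$-coloring of a set $A\subseteq\mathbb{N}$ is a function $\Delta:A\to\{0,1,\ldots,r-1\}$. For integers $r,k\geq 2$, $f_r(k)$ denotes the smallest positive integer $n$ such that every $r$-coloring $\Delta$ of $\{1,2,\ldots,n\}$ has a monochromatic solution to $1/x_1+\cdots+1/x_k=1/y$, i.e. elements $a_1,\ldots,a_k,b$ (with $a_1,\ldots,a_k$ not necessarily distinct) with $1/a_1+\cdots+1/a_k=1/b$ and $\Delta(a_1)=\cdots=\Delta(a_k)=\Delta(b)$. *)

theory Defs
  imports Complex_Main "HOL-Library.FuncSet" "HOL-Library.Ramsey"
begin

definition colorings :: "nat \<Rightarrow> nat set \<Rightarrow> (nat \<Rightarrow> nat) set" where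
  "colorings r A = A \<rightarrow> {0..<r}"

definition has_mono_solution :: "nat \<Rightarrow> nat set \<Rightarrow> (nat \<Rightarrow> nat) \<Rightarrow> bool" where
  "has_mono_solution k A \<Delta> \<longleftrightarrow>
     (\<exists>a b. (\<forall>i\<in>{1..k}. a i \<in> A) \<and> b \<in> A \<and>
        (\<Sum>i=1..k. 1 / real (a i)) = 1 / real b \<and>
        (\<forall>i\<in>{1..k}. \<Delta> (a i) = \<Delta> b))"

definition good :: "nat \<Rightarrow> nat \<Rightarrow> nat \<Rightarrow> bool" where
  "good r k n \<longleftrightarrow> (\<forall>\<Delta>\<in>colorings r {1..n}. has_mono_solution k {1..n} \<Delta>)"

definition f_num :: "nat \<Rightarrow> nat \<Rightarrow> nat" where
  "f_num r k = (LEAST n. n > 0 \<and> good r k n)"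

text \<open>The minimum defining \<^const>\<open>f_num\<close> is attained: apply Ramsey's theorem to the vertices
  \<open>{..<N}\<close>, giving the edge \<open>{x, y}\<close> with \<open>x < y\<close> the color of \<open>N! / (y - x)\<close>. The consecutive
  differences in a monochromatic clique of size \<open>k + 1\<close> add up to the largest difference.\<close>

lemma good_exists:
  assumes "k \<ge> 1"
  shows "\<exists>n>0. good r k n"
proof -
  obtain N :: nat where N: "partn_lst {..<N} (replicate r (Suc k)) 2"
    using ramsey_full by blast
  define L :: nat where "L = fact N"
  have Lpos: "L > 0" by (simp add: L_def)
  have quot: "L div d \<in> {1..L} \<and> 1 / real (L div d) = real d / real L"
    if "0 < d" "d < N" for d
  proof -
    have "d dvd L" using that unfolding L_def by (intro dvd_fact) auto
    then obtain q where q: "L = d * q" by (elim dvdE)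
    then have "q > 0" using Lpos by (cases q) auto
    then show ?thesis using q that by (auto simp: field_simps)
  qed
  have "has_mono_solution k {1..L} \<Delta>" if \<Delta>: "\<Delta> \<in> colorings r {1..L}" for \<Delta>
  proof -
    define c where "c = (\<lambda>e::nat set. \<Delta> (L div (Max e - Min e)))"
    have c2: "c {x, y} = \<Delta> (L div (y - x))" if "x < y" for x y
      using that by (simp add: c_def max_def min_def)
    have "c \<in> nsets {..<N} 2 \<rightarrow> {..<r}"
    proof
      fix e assume "e \<in> nsets {..<N} 2"
      then obtain x y where e: "e = {x, y}" "x < N" "y < N" "x < y"
        by (auto simp: ordered_nsets_2_eq)
      then have "L div (y - x) \<in> {1..L}" using quot[of "y - x"] by auto
      then show "c e \<in> {..<r}" using \<Delta> e c2 by (auto simp: colorings_def Pi_iff)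
    qed
    then obtain j H where H: "j < r" "H \<in> nsets {..<N} (Suc k)" "c ` nsets H 2 \<subseteq> {j}"
      using partn_lstE[OF N, of c r] by (metis length_replicate nth_replicate)
    define xs where "xs = sorted_list_of_set H"
    have finH: "finite H" "card H = Suc k" "H \<subseteq> {..<N}"
      using H(2) by (auto simp: nsets_def)
    have len: "length xs = Suc k" and set_xs: "set xs = H"
      using finH by (auto simp: xs_def)
    have less: "xs ! i < xs ! l" if "i < l" "l \<le> k" for i l
      using sorted_wrt_nth_less[OF strict_sorted_list_of_set[of H], of i l] that len
      by (simp add: xs_def)
    have inH: "xs ! i \<in> H" if "i \<le> k" for i
      using that len set_xs nth_mem[of i xs] by auto
    have ltN: "xs ! i < N" if "i \<le> k" for i
      using inH[OF that] finH by auto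
    have col: "\<Delta> (L div (xs ! l - xs ! i)) = j" if "i < l" "l \<le> k" for i l
    proof -
      have "{xs ! i, xs ! l} \<in> nsets H 2" using inH[of i] inH[of l] less[of i l] that by auto
      then have "c {xs ! i, xs ! l} = j" using H(3) by blast
      then show ?thesis using c2 less[OF that] by simp
    qed
    have q: "L div (xs ! l - xs ! i) \<in> {1..L} \<and>
        1 / real (L div (xs ! l - xs ! i)) = (real (xs ! l) - real (xs ! i)) / real L"
      if "i < l" "l \<le> k" for i l
      using quot[of "xs ! l - xs ! i"] less[OF that] ltN[of l] that by auto
    define a where "a = (\<lambda>i. L div (xs ! i - xs ! (i - 1)))"
    define b where "b = L div (xs ! k - xs ! 0)"
    have tele: "(\<Sum>i=1..m. real (xs ! i) - real (xs ! (i - 1))) = real (xs ! m) - real (xs ! 0)"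
      for m by (induction m) auto
    have "(\<Sum>i=1..k. 1 / real (a i)) =
        (\<Sum>i=1..k. (real (xs ! i) - real (xs ! (i - 1))) / real L)"
      by (intro sum.cong refl) (use q in \<open>auto simp: a_def\<close>)
    also have "\<dots> = (real (xs ! k) - real (xs ! 0)) / real L"
      by (subst sum_divide_distrib[symmetric]) (simp only: tele)
    also have "\<dots> = 1 / real b"
      using q[of 0 k] assms by (simp add: b_def)
    finally have eq: "(\<Sum>i=1..k. 1 / real (a i)) = 1 / real b" .
    have "\<forall>i\<in>{1..k}. a i \<in> {1..L} \<and> \<Delta> (a i) = j"
      using q col by (auto simp: a_def)
    moreover have "b \<in> {1..L}" "\<Delta> b = j"
      using q[of 0 k] col[of 0 k] assms by (auto simp: b_def)
    ultimately show ?thesis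
      unfolding has_mono_solution_def using eq by blast
  qed
  then show ?thesis using Lpos unfolding good_def by blast
qed

end

theory Submission
  imports Defs
begin

text \<open>Color \<open>x\<close> by the index \<open>j\<close> with \<open>k ^ j \<le> x < k ^ (j + 1)\<close>. In any solution the largest
  \<open>x\<^sub>i\<close> is at least \<open>k * y\<close>, since otherwise every \<open>1 / x\<^sub>i\<close> would exceed \<open>1 / (k * y)\<close>; hence it
  lies in a later block than \<open>y\<close>, and no solution is monochromatic. Below \<open>k ^ r\<close> only \<open>r\<close> colors
  occur.\<close>

lemma reciprocal_sum_large_term:
  fixes a :: "nat \<Rightarrow> nat"
  assumes "k \<ge> 1" "b > 0" "\<And>i. i \<in> {1..k} \<Longrightarrow> a i > 0"
    and sum: "(\<Sum>i=1..k. 1 / real (a i)) = 1 / real b"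
  obtains i where "i \<in> {1..k}" "k * b \<le> a i"
proof (rule ccontr)
  assume "\<not> thesis"
  then have small: "a i < k * b" if "i \<in> {1..k}" for i
    using that \<open>\<And>i. \<lbrakk>i \<in> {1..k}; k * b \<le> a i\<rbrakk> \<Longrightarrow> thesis\<close> not_le by blast
  have "(\<Sum>i=1..k. 1 / real (k * b)) < (\<Sum>i=1..k. 1 / real (a i))"
  proof (rule sum_strict_mono)
    fix i assume i: "i \<in> {1..k}"
    show "1 / real (k * b) < 1 / real (a i)"
      using small[OF i] assms(1,2) assms(3)[OF i]
      by (intro divide_strict_left_mono) (auto simp flip: of_nat_mult)
  qed (use assms(1) in auto)
  moreover have "(\<Sum>i=1..k. 1 / real (k * b)) = 1 / real b"
    using assms(1) by simp
  ultimately show False using sum by simp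
qed

text \<open>For \<open>k \<ge> 2\<close> and \<open>x \<ge> 1\<close> this is the floor of the
  base-\<open>k\<close> logarithm. As a \<open>LEAST\<close>, attainment gives the upper bound on
  \<open>x\<close> and minimality the lower one.\<close>

definition log_block :: "nat \<Rightarrow> nat \<Rightarrow> nat" where
  "log_block k x = (LEAST j. x < k ^ Suc j)"

lemma less_power_Suc_log_block:
  assumes "k \<ge> 2"
  shows "x < k ^ Suc (log_block k x)"
proof -
  \<comment> \<open>The exponent \<open>x\<close> witnesses that the \<open>LEAST\<close> is
    attained.\<close>
  have "x < k ^ x"
    using assms by (intro power_gt_expt) auto
  also have "\<dots> \<le> k ^ Suc x"
    using assms by (intro power_increasing) auto
  finally show ?thesis
    unfolding log_block_def by (rule LeastI)
qed

lemma power_log_block_le: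
  assumes "x \<ge> 1"
  shows "k ^ log_block k x \<le> x"
proof (cases "log_block k x")
  case (Suc j)
  then have "\<not> x < k ^ Suc j"
    unfolding log_block_def by (intro not_less_Least) simp
  then show ?thesis using Suc by simp
\<comment> \<open>In block 0 the lower end is \<open>k ^ 0 = 1\<close>, hence
  \<open>x \<ge> 1\<close>.\<close>
qed (use assms in simp)

lemma log_block_less:
  assumes "x < k ^ r" "r \<ge> 1"
  shows "log_block k x < r"
proof -
  have "log_block k x \<le> r - 1"
    unfolding log_block_def using assms by (intro Least_le) simp
  then show ?thesis using assms by simp
qed

lemma no_mono_solution_log_block:
  assumes "k \<ge> 2"
  shows "\<not> has_mono_solution k {1..n} (log_block k)"
proof
  assume "has_mono_solution k {1..n} (log_block k)"
  then obtain a b where ab: "\<And>i. i \<in> {1..k} \<Longrightarrow> a i \<in> {1..n}" "b \<in> {1..n}"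
      "(\<Sum>i=1..k. 1 / real (a i)) = 1 / real b"
      "\<And>i. i \<in> {1..k} \<Longrightarrow> log_block k (a i) = log_block k b"
    unfolding has_mono_solution_def by blast
  have "a i > 0" if "i \<in> {1..k}" for i
    using ab(1)[OF that] by simp
  then obtain i where i: "i \<in> {1..k}" "k * b \<le> a i"
    using reciprocal_sum_large_term[of k b a] ab(2,3) assms by auto
  \<comment> \<open>\<open>a i\<close> and \<open>b\<close> share a block, whose upper end is
    \<open>k\<close> times its lower end.\<close>
  have "a i < k * k ^ log_block k b"
    using less_power_Suc_log_block[OF assms, of "a i"] ab(4)[OF i(1)] by simp
  also have "\<dots> \<le> k * b"
    using power_log_block_le[of b k] ab(2) by simp
  finally show False using i(2) by simp
qed

theorem theorem5p3:
  fixes k r :: nat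
  assumes "k \<ge> 2" and "r \<ge> 2"
  shows "f_num r k \<ge> k ^ r"
proof (rule ccontr)
  assume "\<not> f_num r k \<ge> k ^ r"
  then have "log_block k \<in> colorings r {1..f_num r k}"
    using assms by (auto simp: colorings_def intro!: log_block_less)
  \<comment> \<open>Since some good \<open>n > 0\<close> exists, the minimum
    \<open>f_num r k\<close> is itself good.\<close>
  moreover have "good r k (f_num r k)"
    using LeastI_ex[OF good_exists[of k r]] assms unfolding f_num_def by simp
  ultimately show False
    using no_mono_solution_log_block[OF assms(1)] unfolding good_def by blast
qed

end
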